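(* For each fuzzy vector $u\in\mathcal{F}^n$, the following statements are equivalent: (i) $u$ is symmetric. (ii) For each $\alpha\in[0,1]$, $u_\alpha$ is invariant under the action of $O(n)$; that is, $Qt\in u_\alpha$ for all $t\in u_\alpha$ and $Q\in O(n)$. (iii) For each $\alpha\in[0,1]$, $u_\alpha$ is a closed ball centered at the origin. (iv) For each $\alpha\in[0,1]$, $h_u(\alpha,-):S^{n-1}\to\mathbb{R}$ is a (nonnegative) constant function.
   Context: Let $n\geq 1$; $\langle-,-\rangle$ is the standard Euclidean inner product on $\mathbb{R}^n$, $S^{n-1}$ is the unit sphere, and $O(n)$ is the group of $n\times n$ orthogonal matrices. Closed balls are allowed to have radius $0$. A fuzzy vector (of dimension $n$) is a function $u:\mathbb{R}^n\to[0,1]$ such that: (V1) there is $t_0\in\mathbb{R}^n$ with $u(t_0)=1$; (V2) the closure of $\{t\in\mathbb{R}^n\mid u(t)>0\}$ is compact; (V3) $\min(u(s),u(t))\leq u(\lambda s+(1-\lambda)t)$ for all $s,t\in\mathbb{R}^n$ and $\lambda\in[0,1]$; (V4) $\{t\in\mathbb{R}^n\mid u(t)\geq\alpha\}$ is closed for all $\alpha\in[0,1]$. $\mathcal{F}^n$ is the set of all fuzzy vectors of dimension $n$. The level sets are $u_\alpha=\{t\mid u(t)\geq\alpha\}$ for $\alpha\in(0,1]$ and $u_0=\overline{\{t\mid u(t)>0\}}$. The support function of $u\in\mathcal{F}^n$ is $h_u:[0,1]\times S^{n-1}\to\mathbb{R}$, $h_u(\alpha,x):=\sup_{t\in u_\alpha}\langle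 t,x\rangle$. A fuzzy vector $u$ is symmetric (around the origin) if $u(t)=u(Qt)$ for all $t\in\mathbb{R}^n$ and $Q\in O(n)$. *)

theory Defs
  imports "HOL-Analysis.Analysis"
begin

definition fuzzy_vectors :: "(real ^ 'n \<Rightarrow> real) set" where
  "fuzzy_vectors = {u.
     (\<forall>t. u t \<in> {0..1}) \<and>
     (\<exists>t0. u t0 = 1) \<and>
     compact (closure {t. u t > 0}) \<and>
     (\<forall>s t. \<forall>l\<in>{0..1}. min (u s) (u t) \<le> u (l *\<^sub>R s + (1 - l) *\<^sub>R t)) \<and>
     (\<forall>\<alpha>\<in>{0..1}. closed {t. u t \<ge> \<alpha>})}"

(* Only meaningful for \<alpha> in [0,1]. *)
definition level_set :: "(real ^ 'n \<Rightarrow> real) \<Rightarrow> real \<Rightarrow> (real ^ 'n) set" where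
  "level_set u \<alpha> = (if \<alpha> = 0 then closure {t. u t > 0} else {t. u t \<ge> \<alpha>})"

(* Only meaningful for \<alpha> in [0,1] and x on the unit sphere; for a fuzzy vector the supremum
   is then over a nonempty bounded set, so the real-valued SUP is the genuine one. *)
definition support_fun :: "(real ^ 'n \<Rightarrow> real) \<Rightarrow> real \<Rightarrow> real ^ 'n \<Rightarrow> real" where
  "support_fun u \<alpha> x = (SUP t\<in>level_set u \<alpha>. t \<bullet> x)"

definition symmetric_fuzzy :: "(real ^ 'n \<Rightarrow> real) \<Rightarrow> bool" where
  "symmetric_fuzzy u \<longleftrightarrow> (\<forall>t. \<forall>Q. orthogonal_matrix Q \<longrightarrow> u t = u (Q *v t))"

end

theory Submission
  imports Defs
begin

text \<open>
  The geometric content sits in the level sets, which for a fuzzy vector are nonempty, compact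
  and convex.  Such a set is recovered from its support function by separation from points
  outside it; hence a constant support function \<open>c\<close> forces the set to be the ball of radius \<open>c\<close>
  around the origin (lemma \<open>eq_cball_if_support_const\<close>), where \<open>c \<ge> 0\<close> because the support values
  in two opposite directions cannot both be negative.  An \<open>O(n)\<close>-invariant set has a constant
  support function since \<open>O(n)\<close> acts transitively on the unit sphere (lemma
  \<open>support_const_if_orthogonal_invariant\<close>), and balls are plainly \<open>O(n)\<close>-invariant.  This makes
  invariance of the level sets, being balls, and constancy of the support function equivalent,
  level by level.

  Symmetry of \<open>u\<close> passes to the superlevel sets and, by continuity, to the closure at level \<open>0\<close>.
  Conversely, where \<open>u t > 0\<close>, the value \<open>u t\<close> is the largest level whose set contains \<open>t\<close>, so
  invariance of that level set gives \<open>u t \<le> u (Q t)\<close>, which is trivial where \<open>u t = 0\<close>; the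
  reverse inequality comes from the inverse of \<open>Q\<close>.
\<close>

section \<open>Support functions of compact convex sets\<close>

lemma bdd_above_inner_image:
  fixes K :: "'a::euclidean_space set"
  assumes "compact K"
  shows "bdd_above ((\<lambda>t. t \<bullet> x) ` K)"
proof -
  have "compact ((\<lambda>t. t \<bullet> x) ` K)"
    by (intro compact_continuous_image assms continuous_intros)
  then show ?thesis
    by (simp add: bounded_imp_bdd_above compact_imp_bounded)
qed

lemma support_cball:
  fixes x :: "'a::euclidean_space"
  assumes "norm x = 1" "r \<ge> 0"
  shows "(SUP t\<in>cball 0 r. t \<bullet> x) = r"
proof (rule cSup_eq_maximum)
  show "r \<in> (\<lambda>t. t \<bullet> x) ` cball 0 r"
    using assms by (intro image_eqI[of _ _ "r *\<^sub>R x"]) (auto simp: power2_norm_eq_inner[symmetric])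
  fix y assume "y \<in> (\<lambda>t. t \<bullet> x) ` cball 0 r"
  then obtain t where "y = t \<bullet> x" "norm t \<le> r" by auto
  then show "y \<le> r"
    using norm_cauchy_schwarz[of t x] assms by simp
qed

text \<open>
  The supremum bounds the norm of each point of \<open>K\<close> in its own direction, and a point of the
  ball outside \<open>K\<close> could be separated from \<open>K\<close> by a hyperplane whose unit normal would then
  have support value below \<open>c\<close>.
\<close>
lemma eq_cball_if_support_const:
  fixes K :: "'a::euclidean_space set"
  assumes K: "compact K" "convex K" "K \<noteq> {}"
    and c: "\<And>x. norm x = 1 \<Longrightarrow> (SUP t\<in>K. t \<bullet> x) = c"
  shows "c \<ge> 0 \<and> K = cball 0 c"
proof -
  have upper: "t \<bullet> x \<le> c" if "t \<in> K" "norm x = 1" for t x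
    using cSUP_upper[OF that(1) bdd_above_inner_image[OF K(1), of x]] c[OF that(2)] by simp
  obtain t0 where t0: "t0 \<in> K" using K(3) by auto
  obtain b :: 'a where "b \<in> Basis" using nonempty_Basis by blast
  then have "norm b = 1" by simp
  with upper[OF t0, of b] upper[OF t0, of "- b"] have c0: "c \<ge> 0" by simp
  have "norm t \<le> c" if "t \<in> K" for t
  proof (cases "t = 0")
    case False
    then have "t \<bullet> sgn t = norm t"
      by (simp add: sgn_div_norm dot_square_norm power2_eq_square)
    with upper[OF that, of "sgn t"] False show ?thesis
      by (simp add: norm_sgn)
  qed (simp add: c0)
  moreover have "s \<in> K" if s: "norm s \<le> c" for s
  proof (rule ccontr)
    assume "s \<notin> K"
    then obtain a d where ad: "a \<bullet> s < d" "\<And>t. t \<in> K \<Longrightarrow> a \<bullet> t > d"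
      using separating_hyperplane_closed_point[OF K(2) compact_imp_closed[OF K(1)]] by blast
    then have "a \<noteq> 0" using t0 by force
    \<comment> \<open>the outward normal at the separating hyperplane, so that \<open>K\<close> lies on its negative side\<close>
    define x where "x = - sgn a"
    have x: "norm x = 1" using \<open>a \<noteq> 0\<close> by (simp add: x_def norm_sgn)
    have eq: "t \<bullet> x = - (a \<bullet> t) / norm a" for t
      by (simp add: x_def sgn_div_norm inner_commute field_simps)
    have "(SUP t\<in>K. t \<bullet> x) \<le> - d / norm a"
      using K(3) ad(2) \<open>a \<noteq> 0\<close>
      by (intro cSUP_least) (auto simp: eq divide_right_mono less_imp_le)
    also have "\<dots> < s \<bullet> x"
      using ad(1) \<open>a \<noteq> 0\<close> by (simp add: eq divide_strict_right_mono)
    also have "\<dots> \<le> c"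
      using norm_cauchy_schwarz[of s x] x s by simp
    finally show False using c[OF x] by simp
  qed
  ultimately show ?thesis using c0 by auto
qed

section \<open>Invariance under the orthogonal group\<close>

definition orthogonal_invariant :: "(real ^ 'n) set \<Rightarrow> bool" where
  "orthogonal_invariant K \<longleftrightarrow> (\<forall>t\<in>K. \<forall>Q. orthogonal_matrix Q \<longrightarrow> Q *v t \<in> K)"

lemma orthogonal_matrix_vector_transpose:
  fixes Q :: "real ^ 'n ^ 'n"
  assumes "orthogonal_matrix Q"
  shows "transpose Q *v (Q *v t) = t"
  using assms by (simp add: orthogonal_matrix_def matrix_vector_mul_assoc)

lemma norm_orthogonal_matrix_vector:
  fixes Q :: "real ^ 'n ^ 'n"
  assumes "orthogonal_matrix Q"
  shows "norm (Q *v t) = norm t"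
proof -
  have "orthogonal_transformation ((*v) Q)"
    using assms by (simp add: orthogonal_transformation_matrix)
  then show ?thesis by (rule orthogonal_transformation_norm)
qed

lemma orthogonal_invariant_cball: "orthogonal_invariant (cball 0 r)"
  by (simp add: orthogonal_invariant_def norm_orthogonal_matrix_vector)

text \<open>
  If \<open>Q x = y\<close>, then \<open>t \<bullet> y\<close> and \<open>(Q\<^sup>T t) \<bullet> x\<close> agree, so invariance of \<open>K\<close> makes the supremum
  in direction \<open>y\<close> at most the one in direction \<open>x\<close>.  Such a \<open>Q\<close> exists for any two unit
  vectors.
\<close>
lemma support_const_if_orthogonal_invariant:
  fixes K :: "(real ^ 'n) set"
  assumes K: "compact K" "K \<noteq> {}" "orthogonal_invariant K"
  obtains c where "\<And>x. norm x = 1 \<Longrightarrow> (SUP t\<in>K. t \<bullet> x) = c"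
proof -
  have le: "(SUP t\<in>K. t \<bullet> y) \<le> (SUP t\<in>K. t \<bullet> x)" if xy: "norm x = 1" "norm y = 1" for x y
  proof -
    obtain f where f: "orthogonal_transformation f" "f x = y"
      using orthogonal_transformation_exists[of x y] xy by auto
    define Q where "Q = matrix f"
    have Q: "orthogonal_matrix Q" "Q *v x = y"
      using f by (auto simp: Q_def orthogonal_transformation_matrix matrix_works)
    have tQ: "orthogonal_matrix (transpose Q)"
      using Q(1) by simp
    show ?thesis
    proof (rule cSUP_least[OF K(2)])
      fix t assume "t \<in> K"
      then have "transpose Q *v t \<in> K" using K(3) tQ unfolding orthogonal_invariant_def by blast
      moreover have "t \<bullet> y = (transpose Q *v t) \<bullet> x"
        unfolding Q(2)[symmetric] dot_lmul_matrix[symmetric] by simp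
      ultimately show "t \<bullet> y \<le> (SUP t\<in>K. t \<bullet> x)"
        using cSUP_upper[OF _ bdd_above_inner_image[OF K(1), of x]] by simp
    qed
  qed
  show thesis
  proof (rule that)
    fix x :: "real ^ 'n" assume "norm x = 1"
    then show "(SUP t\<in>K. t \<bullet> x) = (SUP t\<in>K. t \<bullet> axis undefined 1)"
      by (intro antisym le) simp_all
  qed
qed

lemma orthogonal_invariant_closure:
  fixes K :: "(real ^ 'n) set"
  assumes "orthogonal_invariant K"
  shows "orthogonal_invariant (closure K)"
proof -
  have "Q *v t \<in> closure K" if "t \<in> closure K" "orthogonal_matrix Q" for t Q
  proof -
    have "(*v) Q ` closure K \<subseteq> closure ((*v) Q ` K)"
      by (intro closure_bounded_linear_image_subset matrix_vector_mul_bounded_linear)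
    also have "\<dots> \<subseteq> closure K"
      using assms that(2) by (intro closure_mono) (auto simp: orthogonal_invariant_def)
    finally show ?thesis using that(1) by blast
  qed
  then show ?thesis by (simp add: orthogonal_invariant_def)
qed

section \<open>Level sets of fuzzy vectors\<close>

lemma level_set_nonempty:
  assumes "u \<in> fuzzy_vectors" "\<alpha> \<in> {0..1}"
  shows "level_set u \<alpha> \<noteq> {}"
proof -
  obtain t0 where "u t0 = 1" using assms by (auto simp: fuzzy_vectors_def)
  then have "t0 \<in> level_set u \<alpha>"
    using assms closure_subset[of "{t. u t > 0}"] by (auto simp: level_set_def)
  then show ?thesis by auto
qed

lemma compact_level_set:
  assumes "u \<in> fuzzy_vectors" "\<alpha> \<in> {0..1}"
  shows "compact (level_set u \<alpha>)"
proof (cases "\<alpha> = 0")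
  case True
  then show ?thesis using assms by (simp add: level_set_def fuzzy_vectors_def)
next
  case False
  then have "{t. u t \<ge> \<alpha>} \<subseteq> closure {t. u t > 0}"
    using assms(2) closure_subset[of "{t. u t > 0}"] by auto
  moreover have "compact (closure {t. u t > 0})" "closed {t. u t \<ge> \<alpha>}"
    using assms by (auto simp: fuzzy_vectors_def)
  ultimately have "compact {t. u t \<ge> \<alpha>}"
    by (metis compact_Int_closed inf.absorb_iff2)
  then show ?thesis using False by (simp add: level_set_def)
qed

lemma convex_level_set:
  assumes "u \<in> fuzzy_vectors"
  shows "convex (level_set u \<alpha>)"
proof -
  have quasiconcave: "min (u s) (u t) \<le> u (a *\<^sub>R s + b *\<^sub>R t)"
    if "a \<ge> 0" "b \<ge> 0" "a + b = 1" for s t a b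
  proof -
    have "b = 1 - a" "a \<in> {0..1}" using that by auto
    then show ?thesis using assms unfolding fuzzy_vectors_def by blast
  qed
  have "convex {t. u t \<ge> \<alpha>}" "convex {t. u t > 0}"
    unfolding convex_def using quasiconcave
    by (auto simp: min_le_iff_disj) (meson order_trans less_le_trans)+
  then show ?thesis by (simp add: level_set_def)
qed

lemma orthogonal_invariant_level_sets_if_symmetric:
  assumes "symmetric_fuzzy u"
  shows "orthogonal_invariant (level_set u \<alpha>)"
proof -
  have "orthogonal_invariant {t. P (u t)}" for P
    using assms unfolding orthogonal_invariant_def symmetric_fuzzy_def
    by (metis mem_Collect_eq)
  then show ?thesis by (simp add: level_set_def orthogonal_invariant_closure)
qed

lemma symmetric_if_orthogonal_invariant_level_sets:
  assumes u: "u \<in> fuzzy_vectors"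
    and inv: "\<And>\<alpha>. \<alpha> \<in> {0..1} \<Longrightarrow> orthogonal_invariant (level_set u \<alpha>)"
  shows "symmetric_fuzzy u"
proof -
  have range: "u t \<in> {0..1}" for t using u by (simp add: fuzzy_vectors_def)
  have le: "u t \<le> u (Q *v t)" if Q: "orthogonal_matrix Q" for Q t
  proof (cases "u t = 0")
    case True
    then show ?thesis using range[of "Q *v t"] by simp
  next
    case False
    then have "t \<in> level_set u (u t)" by (simp add: level_set_def)
    then have "Q *v t \<in> level_set u (u t)"
      using inv[OF range] Q by (simp add: orthogonal_invariant_def)
    then show ?thesis using False by (simp add: level_set_def)
  qed
  have "u (Q *v t) \<le> u t" if Q: "orthogonal_matrix Q" for Q t
    using le[of "transpose Q" "Q *v t"] Q
    by (simp only: orthogonal_matrix_transpose orthogonal_matrix_vector_transpose)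
  with le show ?thesis by (auto simp: symmetric_fuzzy_def intro: antisym)
qed

section \<open>The characterization\<close>

theorem theorem3p2p3:
  fixes u :: "real ^ 'n \<Rightarrow> real"
  assumes "u \<in> fuzzy_vectors"
  shows
    "(symmetric_fuzzy u \<longleftrightarrow>
        (\<forall>\<alpha>\<in>{0..1}. \<forall>t\<in>level_set u \<alpha>. \<forall>Q. orthogonal_matrix Q \<longrightarrow> Q *v t \<in> level_set u \<alpha>)) \<and>
     (symmetric_fuzzy u \<longleftrightarrow>
        (\<forall>\<alpha>\<in>{0..1}. \<exists>r\<ge>0. level_set u \<alpha> = cball 0 r)) \<and>
     (symmetric_fuzzy u \<longleftrightarrow>
        (\<forall>\<alpha>\<in>{0..1}. \<exists>c. \<forall>x\<in>sphere 0 1. support_fun u \<alpha> x = c)) \<and>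
     (symmetric_fuzzy u \<longleftrightarrow>
        (\<forall>\<alpha>\<in>{0..1}. \<exists>c\<ge>0. \<forall>x\<in>sphere 0 1. support_fun u \<alpha> x = c))"
proof -
  have sym_iff: "symmetric_fuzzy u \<longleftrightarrow> (\<forall>\<alpha>\<in>{0..1}. orthogonal_invariant (level_set u \<alpha>))"
    using assms orthogonal_invariant_level_sets_if_symmetric
      symmetric_if_orthogonal_invariant_level_sets by blast
  have const_if_inv: "\<exists>c. \<forall>x\<in>sphere 0 1. support_fun u \<alpha> x = c"
    if "\<alpha> \<in> {0..1}" "orthogonal_invariant (level_set u \<alpha>)" for \<alpha>
    using support_const_if_orthogonal_invariant[OF compact_level_set[OF assms that(1)]
        level_set_nonempty[OF assms that(1)] that(2)]
    by (metis mem_sphere_0 support_fun_def)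
  have cball_if_const: "\<exists>r\<ge>0. level_set u \<alpha> = cball 0 r"
    if "\<alpha> \<in> {0..1}" "\<exists>c. \<forall>x\<in>sphere 0 1. support_fun u \<alpha> x = c" for \<alpha>
  proof -
    from that(2) obtain c where "\<forall>x\<in>sphere 0 1. support_fun u \<alpha> x = c" by blast
    then have "c \<ge> 0 \<and> level_set u \<alpha> = cball 0 c"
      using compact_level_set[OF assms that(1)] convex_level_set[OF assms]
        level_set_nonempty[OF assms that(1)]
      by (intro eq_cball_if_support_const) (simp_all add: support_fun_def)
    then show ?thesis by blast
  qed
  have nonneg_if_cball: "\<exists>c\<ge>0. \<forall>x\<in>sphere 0 1. support_fun u \<alpha> x = c"
    if "\<exists>r\<ge>0. level_set u \<alpha> = cball 0 r" for \<alpha>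
    using that by (auto simp: support_fun_def support_cball)
  have inv_if_cball: "orthogonal_invariant (level_set u \<alpha>)"
    if "\<exists>r\<ge>0. level_set u \<alpha> = cball 0 r" for \<alpha>
    using that by (auto simp: orthogonal_invariant_cball)
  have ball: "orthogonal_invariant (level_set u \<alpha>) \<longleftrightarrow> (\<exists>r\<ge>0. level_set u \<alpha> = cball 0 r)"
    and const: "orthogonal_invariant (level_set u \<alpha>) \<longleftrightarrow>
      (\<exists>c. \<forall>x\<in>sphere 0 1. support_fun u \<alpha> x = c)"
    and nonneg: "orthogonal_invariant (level_set u \<alpha>) \<longleftrightarrow>
      (\<exists>c\<ge>0. \<forall>x\<in>sphere 0 1. support_fun u \<alpha> x = c)"
    if "\<alpha> \<in> {0..1}" for \<alpha>
    using const_if_inv[OF that] cball_if_const[OF that] nonneg_if_cball inv_if_cball by blast+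
  show ?thesis
    unfolding sym_iff using ball const nonneg
    by (intro conjI ball_cong[OF refl]) (simp_all add: orthogonal_invariant_def)
qed

end
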